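(* Suppose that $c(\cdot)$ is $L_c$-Lipschitz on $S$, i.e. $\|c(w_1)-c(w_2)\|_2\le L_c\|w_1-w_2\|$ for all $w_1,w_2\in S$, and that $\phi$ is 1-strongly convex on the compact set $S$. Then for any $\rho>0$ the optimal solution mapping $w_\rho(\cdot)$ is $(L_c/\rho)$-Lipschitz: $$\|w_\rho(p)-w_\rho(p')\|\le\frac{L_c}{\rho}\|p-p'\|_2\qquad\forall p,p'\in\mathbb{R}^K_+ .$$ Furthermore, $c(w_\rho(\cdot))$ is $(L_c^2/\rho)$-Lipschitz: $$\|c(w_\rho(p))-c(w_\rho(p'))\|_\infty\le\|c(w_\rho(p))-c(w_\rho(p'))\|_2\le\frac{L_c^2}{\rho}\|p-p'\|_2\qquad\forall p,p'\in\mathbb{R}^K_+ .$$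
   Context: $S\subset\mathbb{R}^d$ is a nonempty convex compact set and $\|\cdot\|$ is a norm on $\mathbb{R}^d$. $c_1,\dots,c_K:S\to\mathbb{R}$ are convex functions and $c(\cdot):S\to\mathbb{R}^K$ denotes $w\mapsto(c_1(w),\dots,c_K(w))$. $\phi:S\to\mathbb{R}$ is non-negative and continuous; 1-strong convexity is with respect to $\|\cdot\|$. $\mathbb{R}^K_+:=\{p\in\mathbb{R}^K:p_k\ge0,\ k=1,\dots,K\}$. For $p\in\mathbb{R}^K_+$ and $\rho>0$, $w_\rho(p):=\arg\min_{w\in S}\{\sum_{k=1}^Kp_kc_k(w)+\rho\phi(w)\}$, which is a single point. *)

theory Defs
  imports "HOL-Analysis.Analysis"
begin

text \<open>An arbitrary norm, given as a function, since the norm of the type class is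
  reserved for the Euclidean one.\<close>

definition is_norm :: "('a::real_vector \<Rightarrow> real) \<Rightarrow> bool" where
  "is_norm N \<longleftrightarrow>
     (\<forall>x. 0 \<le> N x) \<and>
     (\<forall>x. N x = 0 \<longleftrightarrow> x = 0) \<and>
     (\<forall>a x. N (a *\<^sub>R x) = \<bar>a\<bar> * N x) \<and>
     (\<forall>x y. N (x + y) \<le> N x + N y)"

text \<open>The convention with the factor 1/2: on Euclidean space, half the squared norm is
  1-strongly convex.\<close>

definition strongly_convex_on ::
  "('a::real_vector \<Rightarrow> real) \<Rightarrow> real \<Rightarrow> 'a set \<Rightarrow> ('a \<Rightarrow> real) \<Rightarrow> bool" where
  "strongly_convex_on N \<mu> S f \<longleftrightarrow> convex S \<and>
     (\<forall>x\<in>S. \<forall>y\<in>S. \<forall>u\<ge>0. \<forall>v\<ge>0. u + v = 1 \<longrightarrow>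
        f (u *\<^sub>R x + v *\<^sub>R y) \<le> u * f x + v * f y - \<mu> / 2 * u * v * (N (x - y))\<^sup>2)"

definition nonneg_orthant :: "(real ^ 'k) set" where
  "nonneg_orthant = {p. \<forall>k. 0 \<le> p $ k}"

text \<open>\<open>arg_min_on\<close> selects some minimizer; it is used only where the minimizer over
  \<open>S\<close> exists and is unique, so the choice is immaterial.\<close>

definition w_opt ::
  "'a set \<Rightarrow> ('a \<Rightarrow> real ^ 'k) \<Rightarrow> ('a \<Rightarrow> real) \<Rightarrow> real \<Rightarrow> real ^ 'k \<Rightarrow> 'a" where
  "w_opt S c \<phi> \<rho> p = arg_min_on (\<lambda>w. (\<Sum>k\<in>UNIV. p $ k * c w $ k) + \<rho> * \<phi> w) S"

end

theory Submission
  imports Defs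
begin

text \<open>The objective at \<open>p\<close> is \<open>\<rho>\<close>-strongly convex, so it exceeds its minimum by
  at least \<open>\<rho> / 2 * (N (y - w))\<^sup>2\<close> at every \<open>y\<close>. Adding this inequality for \<open>p\<close> at the
  minimizer for \<open>p'\<close> to the one with \<open>p\<close> and \<open>p'\<close> exchanged cancels \<open>\<phi>\<close> and leaves
  \<open>\<rho> * (N (w - w'))\<^sup>2 \<le> (p - p') \<bullet> (c w' - c w)\<close>, which Cauchy-Schwarz and the Lipschitz
  bound on \<open>c\<close> turn into the claim.\<close>

lemma is_norm_sum_le:
  assumes "is_norm N" and "finite A"
  shows "N (\<Sum>i\<in>A. g i) \<le> (\<Sum>i\<in>A. N (g i))"
  using assms(2)
proof (induction A rule: finite_induct)
  case empty
  have "N 0 = 0" using assms(1) unfolding is_norm_def by blast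
  then show ?case by simp
next
  case (insert a A)
  have "N (g a + (\<Sum>i\<in>A. g i)) \<le> N (g a) + N (\<Sum>i\<in>A. g i)"
    using assms(1) by (simp add: is_norm_def)
  with insert show ?case by simp
qed

text \<open>Expanding a vector in the standard basis bounds each coordinate by the Euclidean norm,
  so the sum of \<open>N\<close> over \<open>Basis\<close> serves as \<open>C\<close>. This makes
  estimates in \<open>N\<close> usable for the Euclidean topology.\<close>

lemma is_norm_le_norm:
  fixes N :: "'a::euclidean_space \<Rightarrow> real"
  assumes "is_norm N"
  obtains C where "C \<ge> 0" and "\<And>x. N x \<le> C * norm x"
proof
  show "(\<Sum>i\<in>Basis. N i) \<ge> 0"
    using assms by (simp add: is_norm_def sum_nonneg)
  fix x :: 'a
  have "N x = N (\<Sum>i\<in>Basis. (x \<bullet> i) *\<^sub>R i)"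
    by (simp add: euclidean_representation)
  also have "\<dots> \<le> (\<Sum>i\<in>Basis. N ((x \<bullet> i) *\<^sub>R i))"
    by (rule is_norm_sum_le[OF assms finite_Basis])
  also have "\<dots> = (\<Sum>i\<in>Basis. \<bar>x \<bullet> i\<bar> * N i)"
    using assms by (simp add: is_norm_def)
  also have "\<dots> \<le> (\<Sum>i\<in>Basis. norm x * N i)"
    using assms by (intro sum_mono mult_right_mono Basis_le_norm) (auto simp: is_norm_def)
  finally show "N x \<le> (\<Sum>i\<in>Basis. N i) * norm x"
    by (simp add: sum_distrib_left mult.commute)
qed

text \<open>Continuity refers to the Euclidean topology while the Lipschitz bound is in
  \<open>N\<close>; comparing the norms costs only the factor \<open>C\<close>. Applied to
  \<open>c\<close>, this leads to the existence of minimizers on the compact set.\<close>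

lemma continuous_on_is_norm_lipschitz:
  fixes N :: "'a::euclidean_space \<Rightarrow> real" and f :: "'a \<Rightarrow> 'b::real_normed_vector"
  assumes "is_norm N" and "0 \<le> L"
    and lip: "\<And>x y. x \<in> S \<Longrightarrow> y \<in> S \<Longrightarrow> norm (f x - f y) \<le> L * N (x - y)"
  shows "continuous_on S f"
proof -
  obtain C where C: "C \<ge> 0" "\<And>x. N x \<le> C * norm x"
    using is_norm_le_norm[OF assms(1)] by blast
  have "(L * C)-lipschitz_on S f"
  proof (rule lipschitz_onI)
    fix x y assume "x \<in> S" "y \<in> S"
    then have "norm (f x - f y) \<le> L * N (x - y)" by (rule lip)
    also have "\<dots> \<le> L * (C * norm (x - y))" using C assms(2) by (intro mult_left_mono)
    finally show "dist (f x) (f y) \<le> L * C * dist x y" by (simp add: dist_norm mult.assoc)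
  qed (use C assms(2) in simp)
  then show ?thesis by (rule lipschitz_on_continuous_on)
qed

text \<open>\<open>arg_min_on\<close> is a Hilbert choice, so its value is a minimizer as soon as
  one exists, and compactness with continuity provides one.\<close>

lemma arg_min_on_compact:
  fixes f :: "'a::topological_space \<Rightarrow> real"
  assumes "compact S" and "S \<noteq> {}" and "continuous_on S f"
  shows "arg_min_on f S \<in> S" and "\<And>y. y \<in> S \<Longrightarrow> f (arg_min_on f S) \<le> f y"
proof -
  obtain x where "x \<in> S" "\<And>y. y \<in> S \<Longrightarrow> f x \<le> f y"
    using continuous_attains_inf[OF assms] by blast
  then have "is_arg_min f (\<lambda>x. x \<in> S) x" by (auto simp: is_arg_min_linorder)
  then have "is_arg_min f (\<lambda>x. x \<in> S) (arg_min_on f S)"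
    unfolding arg_min_on_def arg_min_def by (rule someI)
  then show "arg_min_on f S \<in> S" and "\<And>y. y \<in> S \<Longrightarrow> f (arg_min_on f S) \<le> f y"
    by (auto simp: is_arg_min_linorder)
qed

lemma strongly_convex_on_cmult:
  assumes "strongly_convex_on N \<mu> S f" and "0 \<le> a"
  shows "strongly_convex_on N (a * \<mu>) S (\<lambda>x. a * f x)"
  unfolding strongly_convex_on_def
proof (intro conjI ballI allI impI)
  show "convex S" using assms(1) by (simp add: strongly_convex_on_def)
  fix x y and u v :: real
  assume "x \<in> S" "y \<in> S" "0 \<le> u" "0 \<le> v" "u + v = 1"
  then have "f (u *\<^sub>R x + v *\<^sub>R y) \<le> u * f x + v * f y - \<mu> / 2 * u * v * (N (x - y))\<^sup>2"
    using assms(1) by (simp add: strongly_convex_on_def)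
  from mult_left_mono[OF this assms(2)]
  show "a * f (u *\<^sub>R x + v *\<^sub>R y)
      \<le> u * (a * f x) + v * (a * f y) - a * \<mu> / 2 * u * v * (N (x - y))\<^sup>2"
    by (simp add: algebra_simps)
qed

lemma strongly_convex_on_add_convex:
  assumes "convex_on S g" and "strongly_convex_on N \<mu> S f"
  shows "strongly_convex_on N \<mu> S (\<lambda>x. g x + f x)"
  unfolding strongly_convex_on_def
proof (intro conjI ballI allI impI)
  show "convex S" using assms(2) by (simp add: strongly_convex_on_def)
  fix x y and u v :: real
  assume *: "x \<in> S" "y \<in> S" "0 \<le> u" "0 \<le> v" "u + v = 1"
  have "f (u *\<^sub>R x + v *\<^sub>R y) \<le> u * f x + v * f y - \<mu> / 2 * u * v * (N (x - y))\<^sup>2"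
    using assms(2) * by (simp add: strongly_convex_on_def)
  moreover have "g (u *\<^sub>R x + v *\<^sub>R y) \<le> u * g x + v * g y"
    using assms(1) * by (simp add: convex_on_def)
  ultimately show "g (u *\<^sub>R x + v *\<^sub>R y) + f (u *\<^sub>R x + v *\<^sub>R y)
      \<le> u * (g x + f x) + v * (g y + f y) - \<mu> / 2 * u * v * (N (x - y))\<^sup>2"
    by (simp add: algebra_simps)
qed

text \<open>Minimality is tested at points of the segment from \<open>w\<close> to \<open>y\<close>.
  Strong convexity there, after cancelling \<open>f w\<close> and dividing by the weight
  \<open>u\<close> of \<open>y\<close>, gives the bound with the factor \<open>1 - u\<close>; this
  factor disappears as \<open>u\<close> tends to 0.\<close>

lemma strongly_convex_on_growth:
  assumes sc: "strongly_convex_on N \<mu> S f"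
    and w: "w \<in> S" "\<And>y. y \<in> S \<Longrightarrow> f w \<le> f y" and y: "y \<in> S"
  shows "f w + \<mu> / 2 * (N (y - w))\<^sup>2 \<le> f y"
proof -
  define A where "A = \<mu> / 2 * (N (y - w))\<^sup>2"
  have ineq: "f w + (1 - u) * A \<le> f y" if u: "0 < u" "u < 1" for u
  proof -
    have "u *\<^sub>R y + (1 - u) *\<^sub>R w \<in> S"
      using sc w(1) y u by (intro convexD) (auto simp: strongly_convex_on_def)
    then have "f w \<le> f (u *\<^sub>R y + (1 - u) *\<^sub>R w)" by (rule w(2))
    also have "\<dots> \<le> u * f y + (1 - u) * f w - \<mu> / 2 * u * (1 - u) * (N (y - w))\<^sup>2"
      using sc w(1) y u by (simp add: strongly_convex_on_def)
    finally have "u * (f w + (1 - u) * A) \<le> u * f y"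
      by (simp add: A_def algebra_simps)
    with u show ?thesis by simp
  qed
  \<comment> \<open>The division by \<open>u\<close> excludes \<open>u = 0\<close>, so the full
    constant is reached only as a limit from the right.\<close>
  have "((\<lambda>u. f w + (1 - u) * A) \<longlongrightarrow> f w + (1 - 0) * A) (at_right 0)"
    by (intro tendsto_intros)
  moreover have "\<forall>\<^sub>F u in at_right 0. f w + (1 - u) * A \<le> f y"
    unfolding eventually_at_right_field using ineq by (intro exI[of _ 1]) auto
  ultimately have "f w + (1 - 0) * A \<le> f y"
    by (rule tendsto_upperbound) simp
  then show ?thesis by (simp add: A_def)
qed

text \<open>Nonnegative weights preserve convexity term by term; this is where the restriction of
  \<open>p\<close> to the orthant enters.\<close>

lemma convex_on_inner_nonneg_orthant:
  fixes c :: "'a::real_vector \<Rightarrow> real ^ 'k"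
  assumes "convex S" and "\<And>k. convex_on S (\<lambda>w. c w $ k)" and "p \<in> nonneg_orthant"
  shows "convex_on S (\<lambda>w. p \<bullet> c w)"
proof -
  have "convex_on S (\<lambda>w. \<Sum>k\<in>A. p $ k * c w $ k)" if "finite A" for A
    using that
  proof (induction A rule: finite_induct)
    case empty
    show ?case using assms(1) by (simp add: convex_on_def)
  next
    case (insert k A)
    have "convex_on S (\<lambda>w. p $ k * c w $ k)"
      using assms(2,3) by (intro convex_on_cmul) (auto simp: nonneg_orthant_def)
    with insert show ?case by (simp add: convex_on_add)
  qed
  from this[OF finite] show ?thesis by (simp add: inner_vec_def)
qed

theorem proposition2:
  fixes S :: "(real ^ 'd) set"
    and N :: "real ^ 'd \<Rightarrow> real"
    and c :: "real ^ 'd \<Rightarrow> real ^ 'k"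
    and \<phi> :: "real ^ 'd \<Rightarrow> real"
    and L\<^sub>c \<rho> :: real
  assumes "S \<noteq> {}" and "convex S" and "compact S"
    and "is_norm N"
    and "\<And>k. convex_on S (\<lambda>w. c w $ k)"
    and "\<And>w. w \<in> S \<Longrightarrow> 0 \<le> \<phi> w"
    and "continuous_on S \<phi>"
    and "0 \<le> L\<^sub>c"
    and "\<And>w1 w2. w1 \<in> S \<Longrightarrow> w2 \<in> S \<Longrightarrow> norm (c w1 - c w2) \<le> L\<^sub>c * N (w1 - w2)"
    and "strongly_convex_on N 1 S \<phi>"
    and "\<rho> > 0"
  shows "(\<forall>p\<in>nonneg_orthant. \<forall>p'\<in>nonneg_orthant.
            N (w_opt S c \<phi> \<rho> p - w_opt S c \<phi> \<rho> p') \<le> L\<^sub>c / \<rho> * norm (p - p')) \<and>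
         (\<forall>p\<in>nonneg_orthant. \<forall>p'\<in>nonneg_orthant.
            infnorm (c (w_opt S c \<phi> \<rho> p) - c (w_opt S c \<phi> \<rho> p'))
              \<le> norm (c (w_opt S c \<phi> \<rho> p) - c (w_opt S c \<phi> \<rho> p')) \<and>
            norm (c (w_opt S c \<phi> \<rho> p) - c (w_opt S c \<phi> \<rho> p'))
              \<le> L\<^sub>c\<^sup>2 / \<rho> * norm (p - p'))"
proof -
  let ?w = "w_opt S c \<phi> \<rho>"
  \<comment> \<open>Writing the weighted sum as an inner product shows the objective as linear in
    \<open>p\<close>, with the term in \<phi> independent of \<open>p\<close>.\<close>
  define F where "F p w = p \<bullet> c w + \<rho> * \<phi> w" for p w
  have w_opt: "?w p = arg_min_on (F p) S" for p
    by (simp add: w_opt_def F_def[abs_def] inner_vec_def)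
  have "continuous_on S c"
    using assms(4,8,9) by (rule continuous_on_is_norm_lipschitz)
  then have "continuous_on S (F p)" for p
    unfolding F_def[abs_def] using assms(7) by (intro continuous_intros)
  then have w_in: "?w p \<in> S" and w_min: "\<And>y. y \<in> S \<Longrightarrow> F p (?w p) \<le> F p y" for p
    unfolding w_opt using arg_min_on_compact assms(1,3) by blast+
  have growth: "F p (?w p) + \<rho> / 2 * (N (y - ?w p))\<^sup>2 \<le> F p y"
    if "p \<in> nonneg_orthant" "y \<in> S" for p y
  proof (rule strongly_convex_on_growth[where f = "F p" and N = N and S = S])
    \<comment> \<open>The modulus \<rho> comes from scaling the 1-strongly convex \<phi>; adding the
      convex term \<open>p \<bullet> c w\<close> preserves it.\<close>
    show "strongly_convex_on N \<rho> S (F p)"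
      unfolding F_def[abs_def]
      using convex_on_inner_nonneg_orthant[OF assms(2,5) that(1)]
        strongly_convex_on_cmult[OF assms(10), of \<rho>] assms(11)
      by (intro strongly_convex_on_add_convex) auto
    show "?w p \<in> S" "y \<in> S" using w_in that by auto
    show "F p (?w p) \<le> F p z" if "z \<in> S" for z using w_min that .
  qed
  have N_nonneg: "0 \<le> N x" for x
    using assms(4) by (simp add: is_norm_def)
  \<comment> \<open>The two growth inequalities measure the same distance in opposite orders;
    homogeneity with the scalar -1 identifies them.\<close>
  have N_commute: "N (x - y) = N (y - x)" for x y
  proof -
    have "N ((-1) *\<^sub>R (y - x)) = \<bar>-1\<bar> * N (y - x)"
      using assms(4) unfolding is_norm_def by blast
    then show ?thesis by simp
  qed
  have lip: "N (?w p - ?w p') \<le> L\<^sub>c / \<rho> * norm (p - p')"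
    if p: "p \<in> nonneg_orthant" and p': "p' \<in> nonneg_orthant" for p p'
  proof -
    let ?n = "N (?w p - ?w p')"
    have "\<rho> * ?n\<^sup>2 \<le> (p - p') \<bullet> (c (?w p') - c (?w p))"
      using growth[OF p w_in, of p'] growth[OF p' w_in, of p] N_commute[of "?w p'" "?w p"]
      by (simp add: F_def inner_diff_left inner_diff_right)
    also have "\<dots> \<le> norm (p - p') * norm (c (?w p') - c (?w p))"
      by (rule norm_cauchy_schwarz)
    also have "\<dots> \<le> norm (p - p') * (L\<^sub>c * ?n)"
      using assms(9)[OF w_in[of p'] w_in[of p]] N_commute[of "?w p'" "?w p"]
      by (intro mult_left_mono) auto
    \<comment> \<open>One factor \<open>?n\<close> is split off to be cancelled. If
      \<open>?n = 0\<close>, cancelling is impossible, but the next bound then holds because its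
      right side is nonnegative.\<close>
    finally have "?n * (\<rho> * ?n) \<le> ?n * (L\<^sub>c * norm (p - p'))"
      by (simp add: power2_eq_square mult_ac)
    then have "\<rho> * ?n \<le> L\<^sub>c * norm (p - p')"
      using N_nonneg[of "?w p - ?w p'"] assms(8) by (cases "?n = 0") auto
    with assms(11) show ?thesis by (simp add: field_simps)
  qed
  \<comment> \<open>Composing \<open>c\<close> with the minimizer map multiplies the constants
    \<open>L\<^sub>c\<close> and \<open>L\<^sub>c / \<rho>\<close>.\<close>
  have "norm (c (?w p) - c (?w p')) \<le> L\<^sub>c\<^sup>2 / \<rho> * norm (p - p')"
    if "p \<in> nonneg_orthant" "p' \<in> nonneg_orthant" for p p'
  proof -
    have "norm (c (?w p) - c (?w p')) \<le> L\<^sub>c * N (?w p - ?w p')"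
      by (rule assms(9)[OF w_in w_in])
    also have "\<dots> \<le> L\<^sub>c * (L\<^sub>c / \<rho> * norm (p - p'))"
      by (rule mult_left_mono[OF lip[OF that] assms(8)])
    finally show ?thesis by (simp add: power2_eq_square)
  qed
  with lip show ?thesis by (simp add: infnorm_le_norm)
qed

end
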